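(* Let $P_{(3,1)}$ be the set of all cylindric partitions with profile $c=(3,1)$. Then, as formal power series in $q$, $$\sum_{\Lambda\in P_{(3,1)}} q^{|\Lambda|}=\left(\sum_{n\ge0}\frac{q^{n^2}}{(q^2;q^2)_n}\right)\frac{(-q^2;q^2)_\infty}{(q;q)_\infty}.$$
   Context: Let $r,\ell$ be positive integers and $c=(c_1,\dots,c_r)$ a composition of $\ell$ into $r$ nonnegative integer parts (zero entries allowed). A cylindric partition with profile $c$ is a tuple $\Lambda=(\lambda^{(1)},\dots,\lambda^{(r)})$ of ordinary partitions $\lambda^{(i)}=(\lambda^{(i)}_1\ge\lambda^{(i)}_2\ge\cdots)$ (parts beyond the length are taken to be $0$) such that for all $i,j$: $\lambda^{(i)}_j\ge\lambda^{(i+1)}_{j+c_{i+1}}$ for $1\le i\le r-1$, and $\lambda^{(r)}_j\ge\lambda^{(1)}_{j+c_1}$. The size $|\Lambda|$ is the sum of all parts of all $\lambda^{(i)}$; the empty cylindric partition is included with size $0$. Notation: $(a;q)_n=\prod_{k=1}^n(1-aq^{k-1})$, $(a;q)_\infty=\lim_{n\to\infty}(a;q)_n$. *)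

theory Defs
  imports "HOL-Analysis.Analysis" "HOL-Computational_Algebra.Formal_Power_Series"
begin

text \<open>
  An ordinary partition is its infinite sequence of parts, padded with zeros. Indices start at 0:
  \<open>p j\<close> is the part usually written with subscript \<open>j + 1\<close>.
\<close>

definition int_partition :: "(nat \<Rightarrow> nat) \<Rightarrow> bool" where
  "int_partition p \<longleftrightarrow> antimono p \<and> finite {j. p j \<noteq> 0}"

text \<open>
  The profile is the list \<open>c\<close> of its \<open>r = length c\<close> entries (meaningful for \<open>c \<noteq> []\<close>); a cylindric
  partition is a list of \<open>r\<close> partitions. List indices start at 0 as well, so \<open>\<Lambda> ! i\<close> and \<open>c ! i\<close>
  are the entries usually numbered \<open>i + 1\<close>.
\<close>

definition cylindric_partitions :: "nat list \<Rightarrow> (nat \<Rightarrow> nat) list set" where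
  "cylindric_partitions c = {\<Lambda>. length \<Lambda> = length c \<and>
     (\<forall>i<length c. int_partition (\<Lambda> ! i)) \<and>
     (\<forall>i<length c - 1. \<forall>j. (\<Lambda> ! i) j \<ge> (\<Lambda> ! (i + 1)) (j + c ! (i + 1))) \<and>
     (\<forall>j. (\<Lambda> ! (length c - 1)) j \<ge> (\<Lambda> ! 0) (j + c ! 0))}"

definition cylindric_size :: "(nat \<Rightarrow> nat) list \<Rightarrow> nat" where
  "cylindric_size \<Lambda> = (\<Sum>i<length \<Lambda>. \<Sum>j | (\<Lambda> ! i) j \<noteq> 0. (\<Lambda> ! i) j)"

definition qpoch :: "'a \<Rightarrow> 'a \<Rightarrow> nat \<Rightarrow> 'a :: comm_ring_1" where
  "qpoch a q n = (\<Prod>k=1..n. 1 - a * q ^ (k - 1))"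

text \<open>For \<open>'a = 'b fps\<close> the limit is taken in the \<open>X\<close>-adic metric of the library.\<close>

definition qpoch_inf :: "'a \<Rightarrow> 'a \<Rightarrow> 'a :: {comm_ring_1, t2_space}" where
  "qpoch_inf a q = lim (\<lambda>n. qpoch a q n)"

end

theory Submission
  imports Defs
begin

text \<open>
  Let \<open>G(a,b)\<close> be the generating function of the cylindric partitions of profile \<open>(3,1)\<close> whose two
  components have at most \<open>a\<close> and \<open>b\<close> parts. Lowering all \<open>a + b\<close> parts by one gives, for
  \<open>-1 \<le> a - b \<le> 3\<close>,
  \<open>(1 - q^(a+b)) G(a,b) = G(a-1,b) + G(a,b-1) - G(a-1,b-1)\<close>,
  and the cylindric inequalities give \<open>G(a,a-4) = G(a-1,a-4)\<close> and \<open>G(b-2,b) = G(b-2,b-1)\<close> at the walls.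
  Each \<open>1 / ((q)_(a+m) (q)_(b-m))\<close> solves the recursion, and the reflection principle selects the
  combination of these that also satisfies the wall conditions. For \<open>a = b \<longrightarrow> \<infinity>\<close> it becomes
  \<open>(\<Sum>n. (-1)^n q^(3n^2+n)) / (q;q)^2\<close> with \<open>n\<close> ranging over the integers, which by the pentagonal
  number theorem is \<open>(q^2;q^2) / (q;q)^2 = (-q;q) / (q;q)\<close> (infinite products). The right-hand side of
  the claim is the same product by Euler's identity
  \<open>(\<Sum>n. q^(n^2) / (q^2;q^2)_n) = (-q;q^2)\<close>.
\<close>

subsection \<open>Limits of formal power series\<close>

text \<open>Congruence modulo q^n is expressed as divisibility by \<open>fps_X ^ n\<close>, so that
  error estimates compose by the general rules for \<open>dvd\<close>.\<close>

lemma fps_X_power_dvd_iff: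
  fixes f :: "'a :: comm_ring_1 fps"
  shows "fps_X ^ n dvd f \<longleftrightarrow> (\<forall>i<n. fps_nth f i = 0)"
proof
  assume "fps_X ^ n dvd f"
  then show "\<forall>i<n. fps_nth f i = 0"
    by (auto simp: fps_X_power_mult_nth)
next
  assume "\<forall>i<n. fps_nth f i = 0"
  then have "f = fps_X ^ n * fps_shift n f"
    by (auto simp: fps_eq_iff fps_X_power_mult_nth)
  then show "fps_X ^ n dvd f"
    by (metis dvd_triv_left)
qed

lemma tendsto_mult_fps:
  fixes a b :: "'a :: comm_ring_1 fps"
  assumes "(f \<longlongrightarrow> a) F" "(g \<longlongrightarrow> b) F"
  shows "((\<lambda>x. f x * g x) \<longlongrightarrow> a * b) F"
proof (rule tendsto_fpsI)
  fix n
  have "\<forall>\<^sub>F x in F. \<forall>i\<in>{..n}. fps_nth (f x) i = fps_nth a i"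
       "\<forall>\<^sub>F x in F. \<forall>i\<in>{..n}. fps_nth (g x) i = fps_nth b i"
    using assms by (auto simp: tendsto_fps_iff eventually_ball_finite_distrib)
  then show "\<forall>\<^sub>F x in F. fps_nth (f x * g x) n = fps_nth (a * b) n"
    by eventually_elim (auto simp: fps_mult_nth intro!: sum.cong)
qed

lemma tendsto_fps_X_power_dvd:
  fixes f g :: "nat \<Rightarrow> 'a :: comm_ring_1 fps"
  assumes "f \<longlonglongrightarrow> a" and "\<And>n. fps_X ^ n dvd f n - g n"
  shows "g \<longlonglongrightarrow> a"
proof (rule tendsto_fpsI)
  fix n
  have "\<forall>\<^sub>F k in sequentially. fps_nth (f k) n = fps_nth a n"
    using assms(1) by (auto simp: tendsto_fps_iff)
  moreover have "\<forall>\<^sub>F k in sequentially. n < k"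
    by (rule eventually_gt_at_top)
  ultimately show "\<forall>\<^sub>F k in sequentially. fps_nth (g k) n = fps_nth a n"
  proof eventually_elim
    case (elim k)
    then show ?case
      using assms(2)[of k] by (auto simp: fps_X_power_dvd_iff)
  qed
qed

text \<open>Coefficient \<open>i\<close> is frozen from term \<open>i\<close> on, so the diagonal is
  the limit. The second conjunct keeps the rate of convergence for later estimates.\<close>

lemma fps_X_power_dvd_imp_convergent:
  fixes f :: "nat \<Rightarrow> 'a :: comm_ring_1 fps"
  assumes "\<And>n. fps_X ^ Suc n dvd f (Suc n) - f n"
  shows "\<exists>L. f \<longlonglongrightarrow> L \<and> (\<forall>n. fps_X ^ Suc n dvd L - f n)"
proof -
  define L where "L = Abs_fps (\<lambda>i. fps_nth (f i) i)"
  have step: "fps_nth (f n) i = fps_nth (f i) i" if "i \<le> n" for i n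
    using that
  proof (induction n rule: dec_induct)
    case (step n)
    then show ?case
      using assms[of n] by (auto simp: fps_X_power_dvd_iff simp del: power_Suc)
  qed simp
  have "f \<longlonglongrightarrow> L"
  proof (rule tendsto_fpsI)
    fix i
    show "\<forall>\<^sub>F n in sequentially. fps_nth (f n) i = fps_nth L i"
      using eventually_ge_at_top[of i] by eventually_elim (subst step, simp_all add: L_def)
  qed
  moreover have "fps_X ^ Suc n dvd L - f n" for n
    unfolding fps_X_power_dvd_iff
  proof (intro allI impI)
    fix i assume "i < Suc n"
    then have "fps_nth (f n) i = fps_nth (f i) i"
      by (intro step) simp
    then show "fps_nth (L - f n) i = 0"
      by (simp add: L_def)
  qed
  ultimately show ?thesis by blast
qed

section \<open>q-Pochhammer products as X-adic limits\<close>

lemma qpoch_0 [simp]: "qpoch a q 0 = 1"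
  by (simp add: qpoch_def)

lemma qpoch_Suc: "qpoch a q (Suc n) = qpoch a q n * (1 - a * q ^ n)"
  by (simp add: qpoch_def)

text \<open>The factor gained at step \<open>n\<close> is \<open>1 - a * q ^ n\<close>, and
  \<open>a * q ^ n\<close> is divisible by \<open>fps_X ^ Suc n\<close>.\<close>

lemma
  fixes a q :: "'a :: comm_ring_1 fps"
  assumes "fps_X dvd a" "fps_X dvd q"
  shows qpoch_tendsto_inf: "qpoch a q \<longlonglongrightarrow> qpoch_inf a q"
    and qpoch_inf_approx: "fps_X ^ Suc n dvd qpoch_inf a q - qpoch a q n"
proof -
  have "fps_X ^ Suc n dvd qpoch a q (Suc n) - qpoch a q n" for n
  proof -
    have "qpoch a q (Suc n) - qpoch a q n = - (a * q ^ n) * qpoch a q n"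
      by (simp add: qpoch_Suc algebra_simps)
    moreover have "fps_X ^ Suc n dvd a * q ^ n"
      using mult_dvd_mono[OF assms(1) dvd_power_same[OF assms(2)]] by simp
    ultimately show ?thesis
      by (metis dvd_minus_iff dvd_mult2)
  qed
  from fps_X_power_dvd_imp_convergent[OF this] obtain L where
    L: "qpoch a q \<longlonglongrightarrow> L" "\<And>n. fps_X ^ Suc n dvd L - qpoch a q n"
    by blast
  have "qpoch_inf a q = L"
    unfolding qpoch_inf_def using L(1) by (rule limI)
  with L show "qpoch a q \<longlonglongrightarrow> qpoch_inf a q" "fps_X ^ Suc n dvd qpoch_inf a q - qpoch a q n"
    by auto
qed

lemma fps_nth_0_qpoch:
  assumes "fps_X dvd (a :: 'a :: comm_ring_1 fps)"
  shows "fps_nth (qpoch a q n) 0 = 1"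
proof (induction n)
  case (Suc n)
  have "fps_nth a 0 = 0"
    using assms by (auto elim: dvdE)
  with Suc show ?case
    by (simp add: qpoch_Suc)
qed simp

lemma fps_nth_0_qpoch_inf:
  assumes "fps_X dvd (a :: 'a :: comm_ring_1 fps)" "fps_X dvd q"
  shows "fps_nth (qpoch_inf a q) 0 = 1"
proof -
  have "fps_X ^ Suc 0 dvd qpoch_inf a q - 1"
    using qpoch_inf_approx[OF assms, of 0] by simp
  then show ?thesis
    unfolding fps_X_power_dvd_iff by simp
qed

subsection \<open>The recursion for bounded cylindric partitions of rank two\<close>

text \<open>The case of profile \<open>[d, e]\<close> with the list replaced by a pair:
  \<open>e\<close> is the shift from the first component to the second, \<open>d\<close> the shift
  back.\<close>

definition cpairs :: "nat \<Rightarrow> nat \<Rightarrow> ((nat \<Rightarrow> nat) \<times> (nat \<Rightarrow> nat)) set" where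
  "cpairs d e = {(l, m). int_partition l \<and> int_partition m \<and>
     (\<forall>j. m (j + e) \<le> l j) \<and> (\<forall>j. l (j + d) \<le> m j)}"

definition weight :: "(nat \<Rightarrow> nat) \<Rightarrow> nat" where
  "weight p = (\<Sum>j | p j \<noteq> 0. p j)"

definition pair_weight :: "(nat \<Rightarrow> nat) \<times> (nat \<Rightarrow> nat) \<Rightarrow> nat" where
  "pair_weight = (\<lambda>(l, m). weight l + weight m)"

text \<open>
  The bounds are integers: a negative one admits no partition at all, so the recursion below
  holds without boundary cases at \<open>a = 0\<close> and \<open>b = 0\<close>.
\<close>

definition supported :: "int \<Rightarrow> (nat \<Rightarrow> nat) \<Rightarrow> bool" where
  "supported a p \<longleftrightarrow> 0 \<le> a \<and> (\<forall>j. a \<le> int j \<longrightarrow> p j = 0)"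

definition bounded_cpairs where
  "bounded_cpairs d e a b = {(l, m) \<in> cpairs d e. supported a l \<and> supported b m}"

text \<open>\<open>card\<close> is 0 on infinite sets; \<open>finite_cpairs_weight\<close> excludes
  this for subsets of \<open>cpairs d e\<close>. Rational coefficients make inverses
  available.\<close>

definition gf :: "((nat \<Rightarrow> nat) \<times> (nat \<Rightarrow> nat)) set \<Rightarrow> rat fps" where
  "gf A = Abs_fps (\<lambda>n. of_nat (card {p \<in> A. pair_weight p = n}))"

lemma weight_eq:
  assumes "\<And>j. n \<le> j \<Longrightarrow> p j = 0"
  shows "weight p = (\<Sum>j<n. p j)"
  unfolding weight_def
proof (rule sum.mono_neutral_left)
  show "{j. p j \<noteq> 0} \<subseteq> {..<n}"
  proof
    fix j assume "j \<in> {j. p j \<noteq> 0}"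
    with assms[of j] show "j \<in> {..<n}"
      by (cases "n \<le> j") auto
  qed
qed auto

lemma int_partition_zero:
  assumes "int_partition p" "p i = 0" "i \<le> j"
  shows "p j = 0"
  using assms by (metis antimonoD int_partition_def le_zero_eq)

text \<open>A nonzero part at index \<open>j\<close> forces \<open>j + 1\<close> parts of size at
  least 1. So the weight bounds both the parts and their number, which gives finiteness
  below.\<close>

lemma int_partition_weight_bounds:
  assumes "int_partition p"
  shows "p j \<le> weight p" and "weight p \<le> j \<Longrightarrow> p j = 0"
proof -
  from assms have fin: "finite {j. p j \<noteq> 0}" by (simp add: int_partition_def)
  show "p j \<le> weight p"
    unfolding weight_def using member_le_sum[of j "{j. p j \<noteq> 0}" p] fin
    by (cases "p j = 0") auto
  show "p j = 0" if "weight p \<le> j"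
  proof (rule ccontr)
    assume "p j \<noteq> 0"
    then have nz: "p i \<noteq> 0" if "i \<le> j" for i
      using int_partition_zero[OF assms _ that] by auto
    have "Suc j = (\<Sum>i\<le>j. 1)" by simp
    also have "\<dots> \<le> (\<Sum>i\<le>j. p i)"
      using nz by (intro sum_mono) (simp add: Suc_leI)
    also have "\<dots> \<le> weight p"
      unfolding weight_def using fin nz by (intro sum_mono2) auto
    finally show False using that by simp
  qed
qed

lemma finite_cpairs_weight:
  "finite {p \<in> cpairs d e. pair_weight p = n}"
proof -
  define A where "A = {p :: nat \<Rightarrow> nat. \<forall>j. (j \<in> {..<n} \<longrightarrow> p j \<in> {..n}) \<and> (j \<notin> {..<n} \<longrightarrow> p j = 0)}"
  have "finite A"
    unfolding A_def by (rule finite_set_of_finite_funs) auto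
  moreover have "p \<in> A" if "int_partition p" "weight p \<le> n" for p
    using int_partition_weight_bounds[OF that(1)] that(2)
    by (auto simp: A_def intro: order_trans)
  then have "{p \<in> cpairs d e. pair_weight p = n} \<subseteq> A \<times> A"
    by (auto simp: cpairs_def pair_weight_def)
  ultimately show ?thesis
    by (meson finite_SigmaI finite_subset)
qed

lemma gf_union_inter:
  assumes "A \<subseteq> cpairs d e" "B \<subseteq> cpairs d e"
  shows "gf (A \<union> B) + gf (A \<inter> B) = gf A + gf B"
proof (rule fps_ext)
  fix n
  let ?S = "\<lambda>A. {p \<in> A. pair_weight p = n}"
  have "finite (?S A)" "finite (?S B)"
    using assms by (auto intro!: finite_subset[OF _ finite_cpairs_weight[of d e n]])
  from card_Un_Int[OF this]
  have "card (?S A) + card (?S B) = card (?S (A \<union> B)) + card (?S (A \<inter> B))"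
    by (simp add: Collect_disj_eq Collect_conj_eq Int_Un_distrib2 conj_disj_distribR Int_ac)
  then show "fps_nth (gf (A \<union> B) + gf (A \<inter> B)) n = fps_nth (gf A + gf B) n"
    by (simp add: gf_def flip: of_nat_add)
qed

lemma gf_shift:
  assumes "inj_on f A" "\<And>p. p \<in> A \<Longrightarrow> pair_weight (f p) = pair_weight p + k"
  shows "gf (f ` A) = fps_X ^ k * gf A"
proof (rule fps_ext)
  fix n
  have "{p \<in> f ` A. pair_weight p = n} = (if n < k then {} else f ` {p \<in> A. pair_weight p = n - k})"
    using assms(2) by auto
  moreover have "card (f ` {p \<in> A. pair_weight p = n - k}) = card {p \<in> A. pair_weight p = n - k}"
    by (rule card_image) (use assms(1) in \<open>auto simp: inj_on_def\<close>)
  ultimately show "fps_nth (gf (f ` A)) n = fps_nth (fps_X ^ k * gf A) n"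
    by (auto simp: gf_def fps_X_power_mult_nth)
qed

text \<open>The inverse of lowering the first \<open>a\<close> parts by one; in this direction no
  truncated subtraction occurs.\<close>

definition raise :: "int \<Rightarrow> (nat \<Rightarrow> nat) \<Rightarrow> nat \<Rightarrow> nat" where
  "raise a p j = (if int j < a then Suc (p j) else p j)"

lemma int_partition_supported_raise:
  assumes "0 \<le> a"
  shows "int_partition (raise a p) \<and> supported a (raise a p) \<longleftrightarrow> int_partition p \<and> supported a p"
proof -
  have fin: "finite {j. p j \<noteq> 0}" if "supported a p" for p
  proof (rule finite_subset)
    have "\<not> a \<le> int j" if "p j \<noteq> 0" for j
      using that \<open>supported a p\<close> by (auto simp: supported_def)
    then show "{j. p j \<noteq> 0} \<subseteq> {..<nat a}"
      by (auto simp: not_le nat_less_eq_zless zless_nat_eq_int_zless)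
  qed auto
  have sup: "supported a (raise a p) \<longleftrightarrow> supported a p"
    by (auto simp: supported_def raise_def)
  have "antimono (raise a p) \<longleftrightarrow> antimono p" if "supported a p"
  proof
    assume anti: "antimono (raise a p)"
    show "antimono p"
    proof (rule antimonoI)
      fix i j :: nat assume "i \<le> j"
      with antimonoD[OF anti this] that show "p j \<le> p i"
        by (cases "int j < a") (auto simp: raise_def supported_def split: if_splits)
    qed
  next
    assume anti: "antimono p"
    show "antimono (raise a p)"
    proof (rule antimonoI)
      fix i j :: nat assume "i \<le> j"
      with antimonoD[OF anti this] show "raise a p j \<le> raise a p i"
        by (auto simp: raise_def)
    qed
  qed
  with fin sup show ?thesis
    unfolding int_partition_def by blast
qed

lemma weight_raise:
  assumes "supported a p"
  shows "weight (raise a p) = weight p + nat a"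
proof -
  have "weight (raise a p) = (\<Sum>j<nat a. raise a p j)"
    by (rule weight_eq) (use assms in \<open>auto simp: raise_def supported_def\<close>)
  also have "\<dots> = (\<Sum>j<nat a. p j + 1)"
    by (rule sum.cong) (auto simp: raise_def)
  also have "\<dots> = (\<Sum>j<nat a. p j) + nat a"
    by (simp add: sum.distrib del: add_Suc_right)
  also have "(\<Sum>j<nat a. p j) = weight p"
    by (rule weight_eq [symmetric]) (use assms in \<open>auto simp: supported_def\<close>)
  finally show ?thesis .
qed

lemma inj_raise: "inj (raise a)"
proof (rule injI, rule ext)
  fix p p' j assume "raise a p = raise a p'"
  from fun_cong[OF this, of j] show "p j = p' j"
    by (simp add: raise_def split: if_splits)
qed

text \<open>If \<open>m (j + e)\<close> is raised, then \<open>j < b - e \<le> a\<close>, so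
  \<open>l j\<close> is raised too; otherwise \<open>m (j + e)\<close> is 0 and the inequality is
  trivial. The other inequality is symmetric, with \<open>a - b \<le> d\<close>.\<close>

lemma bounded_cpairs_raise:
  assumes "0 \<le> a" "0 \<le> b" "a - b \<le> int d" "b - a \<le> int e"
  shows "(raise a l, raise b m) \<in> bounded_cpairs d e a b \<longleftrightarrow> (l, m) \<in> bounded_cpairs d e a b"
proof -
  have "raise b m (j + e) \<le> raise a l j \<longleftrightarrow> m (j + e) \<le> l j" if "supported b m" for j
    using that assms by (cases "int (j + e) < b"; cases "int j < a") (auto simp: raise_def supported_def)
  moreover have "raise a l (j + d) \<le> raise b m j \<longleftrightarrow> l (j + d) \<le> m j" if "supported a l" for j
    using that assms by (cases "int (j + d) < a"; cases "int j < b") (auto simp: raise_def supported_def)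
  ultimately show ?thesis
    using int_partition_supported_raise[OF assms(1), of l] int_partition_supported_raise[OF assms(2), of m]
    by (auto simp: bounded_cpairs_def cpairs_def)
qed

text \<open>Either the first \<open>a\<close> parts are all positive and can be lowered, or one of
  them is 0 and then so is the last, at index \<open>a - 1\<close>.\<close>

lemma supported_cases:
  assumes "int_partition p" "supported a p"
  shows "supported (a - 1) p \<or> (\<exists>p'. p = raise a p')"
proof (cases "\<forall>j. int j < a \<longrightarrow> p j \<noteq> 0")
  case True
  then have "p = raise a (\<lambda>j. if int j < a then p j - 1 else p j)"
    by (auto simp: raise_def fun_eq_iff)
  then show ?thesis by blast
next
  case False
  then obtain i where i: "int i < a" "p i = 0" by blast
  have "p j = 0" if "a - 1 \<le> int j" for j
    by (rule int_partition_zero[OF assms(1) i(2)]) (use that i in auto)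
  then show ?thesis
    using i by (auto simp: supported_def)
qed

lemma supported_raise_pred: "\<not> supported (a - 1) (raise a p)"
proof
  assume *: "supported (a - 1) (raise a p)"
  then have "raise a p (nat (a - 1)) = 0" "0 \<le> a - 1"
    unfolding supported_def by auto
  then show False by (auto simp: raise_def split: if_splits)
qed

lemma supported_mono: "supported a p \<Longrightarrow> a \<le> b \<Longrightarrow> supported b p"
  by (auto simp: supported_def)

lemma bounded_cpairs_subset: "bounded_cpairs d e a b \<subseteq> cpairs d e"
  by (auto simp: bounded_cpairs_def)

lemma gf_empty [simp]: "gf {} = 0"
  by (simp add: gf_def fps_zero_def)

text \<open>\<open>R\<close> holds the pairs with all \<open>a + b\<close> parts positive, a copy of
  the whole set shifted by weight \<open>a + b\<close>. In \<open>U\<close> some bound can be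
  lowered, which inclusion-exclusion counts. At \<open>a = b = 0\<close> both sides vanish, so
  \<open>gf_bounded_00\<close> must supply the initial value.\<close>

lemma gf_bounded_rec:
  assumes "0 \<le> a" "0 \<le> b" "a - b \<le> int d" "b - a \<le> int e"
  shows "(1 - fps_X ^ nat (a + b)) * gf (bounded_cpairs d e a b) =
    gf (bounded_cpairs d e (a - 1) b) + gf (bounded_cpairs d e a (b - 1))
    - gf (bounded_cpairs d e (a - 1) (b - 1))"
proof -
  let ?C = "bounded_cpairs d e"
  define R where "R = (\<lambda>(l, m). (raise a l, raise b m)) ` ?C a b"
  define U where "U = ?C (a - 1) b \<union> ?C a (b - 1)"
  have sub: "?C a' b' \<subseteq> ?C a b" if "a' \<le> a" "b' \<le> b" for a' b'
    using that by (auto simp: bounded_cpairs_def intro: supported_mono)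
  have R: "R \<subseteq> ?C a b"
    by (auto simp: R_def bounded_cpairs_raise[OF assms])
  have cover: "p \<in> U \<union> R" if p: "p \<in> ?C a b" for p
  proof -
    obtain l m where lm: "p = (l, m)" by force
    from p lm have "int_partition l" "int_partition m" "supported a l" "supported b m"
      by (auto simp: bounded_cpairs_def cpairs_def)
    then consider "supported (a - 1) l" | "supported (b - 1) m" | l' m' where "l = raise a l'" "m = raise b m'"
      using supported_cases by metis
    then show ?thesis
    proof cases
      case 3
      with p lm have "(l', m') \<in> ?C a b"
        using bounded_cpairs_raise[OF assms] by simp
      with 3 lm show ?thesis by (force simp: R_def)
    qed (use p lm in \<open>auto simp: U_def bounded_cpairs_def\<close>)
  qed
  have eq: "?C a b = U \<union> R"
    using cover R sub[of "a - 1" b] sub[of a "b - 1"] by (auto simp: U_def)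
  have disj: "U \<inter> R = {}"
    by (auto simp: U_def R_def bounded_cpairs_def supported_raise_pred)
  have "?C (a - 1) b \<inter> ?C a (b - 1) = ?C (a - 1) (b - 1)"
    by (auto simp: bounded_cpairs_def intro: supported_mono)
  then have U: "gf U + gf (?C (a - 1) (b - 1)) = gf (?C (a - 1) b) + gf (?C a (b - 1))"
    unfolding U_def using gf_union_inter[OF bounded_cpairs_subset bounded_cpairs_subset] by metis
  have "gf R = fps_X ^ nat (a + b) * gf (?C a b)"
    unfolding R_def
  proof (rule gf_shift)
    show "inj_on (\<lambda>(l, m). (raise a l, raise b m)) (?C a b)"
      using inj_raise by (auto simp: inj_on_def dest: injD)
    show "pair_weight ((\<lambda>(l, m). (raise a l, raise b m)) p) = pair_weight p + nat (a + b)"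
      if "p \<in> ?C a b" for p
      using that assms
      by (auto simp: pair_weight_def bounded_cpairs_def weight_raise nat_add_distrib)
  qed
  moreover have "gf (?C a b) = gf U + gf R"
  proof -
    have "U \<subseteq> cpairs d e" "R \<subseteq> cpairs d e"
      using R by (auto simp: U_def bounded_cpairs_def)
    from gf_union_inter[OF this] show ?thesis
      by (simp add: disj eq)
  qed
  ultimately show ?thesis
    using U by (simp add: algebra_simps)
qed

lemma supported_pred:
  assumes "supported a p" "1 \<le> a \<Longrightarrow> p (nat (a - 1)) = 0" "1 \<le> a"
  shows "supported (a - 1) p"
  unfolding supported_def
proof (intro conjI allI impI)
  fix j assume j: "a - 1 \<le> int j"
  show "p j = 0"
  proof (cases "int j = a - 1")
    case True
    then have "j = nat (a - 1)" by simp
    with assms show ?thesis by simp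
  qed (use j assms in \<open>auto simp: supported_def\<close>)
qed (use assms in auto)

text \<open>Here \<open>a - b = d + 1\<close>, one step outside the strip of the recursion. Part
  \<open>a - 1\<close> of \<open>l\<close> lies below part \<open>a - d - 1\<close> of
  \<open>m\<close>, which is already 0.\<close>

lemma bounded_cpairs_left:
  "bounded_cpairs d e a (a - int d - 1) = bounded_cpairs d e (a - 1) (a - int d - 1)"
proof -
  have "supported (a - 1) l" if c: "(l, m) \<in> cpairs d e" and l: "supported a l" and m: "supported (a - int d - 1) m" for l m
  proof (rule supported_pred[OF l])
    have a: "a \<ge> int d + 1" using m by (auto simp: supported_def)
    then show "1 \<le> a" by simp
    define k where "k = nat (a - int d - 1)"
    have "nat (a - 1) = k + d" using a by (simp add: k_def nat_diff_distrib)
    moreover have "l (k + d) \<le> m k" using c by (auto simp: cpairs_def)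
    moreover have "m k = 0" using m by (auto simp: supported_def k_def)
    ultimately show "l (nat (a - 1)) = 0" by simp
  qed
  then show ?thesis
    by (auto simp: bounded_cpairs_def intro: supported_mono)
qed

lemma bounded_cpairs_swap:
  "bounded_cpairs e d b a = prod.swap ` bounded_cpairs d e a b"
  by (auto simp: bounded_cpairs_def cpairs_def image_iff)

lemma bounded_cpairs_right:
  "bounded_cpairs d e (b - int e - 1) b = bounded_cpairs d e (b - int e - 1) (b - 1)"
  using bounded_cpairs_left[of e d b] by (simp add: bounded_cpairs_swap[of d e])

lemma bounded_cpairs_empty: "a < 0 \<or> b < 0 \<Longrightarrow> bounded_cpairs d e a b = {}"
  by (auto simp: bounded_cpairs_def supported_def)

section \<open>Initial value and removal of the bounds\<close>

lemma gf_bounded_00: "gf (bounded_cpairs d e 0 0) = 1"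
proof (rule fps_ext)
  fix n
  have "bounded_cpairs d e 0 0 = {(\<lambda>_. 0, \<lambda>_. 0)}"
    by (auto simp: bounded_cpairs_def cpairs_def supported_def int_partition_def antimono_def fun_eq_iff)
  moreover have "{p. p = (\<lambda>_. 0, \<lambda>_. 0) \<and> pair_weight p = n} = (if n = 0 then {(\<lambda>_. 0, \<lambda>_. 0)} else {})"
    by (auto simp: pair_weight_def weight_def)
  ultimately show "fps_nth (gf (bounded_cpairs d e 0 0)) n = fps_nth 1 n"
    by (simp add: gf_def)
qed

text \<open>A partition of weight at most \<open>n\<close> has at most \<open>n\<close> parts, so
  coefficient \<open>n\<close> is final once both bounds reach \<open>n\<close>.\<close>

lemma gf_bounded_tendsto: "(\<lambda>n. gf (bounded_cpairs d e (int n) (int n))) \<longlonglongrightarrow> gf (cpairs d e)"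
proof (rule tendsto_fpsI)
  fix n
  have "{p \<in> bounded_cpairs d e (int k) (int k). pair_weight p = n} = {p \<in> cpairs d e. pair_weight p = n}"
    if "n \<le> k" for k
  proof -
    have "supported (int k) p" if "int_partition p" "weight p \<le> n" for p
      using int_partition_weight_bounds(2)[OF that(1)] that(2) \<open>n \<le> k\<close> by (auto simp: supported_def)
    then show ?thesis
      by (auto simp: bounded_cpairs_def cpairs_def pair_weight_def)
  qed
  then show "\<forall>\<^sub>F k in sequentially. fps_nth (gf (bounded_cpairs d e (int k) (int k))) n = fps_nth (gf (cpairs d e)) n"
    by (intro eventually_mono[OF eventually_ge_at_top[of n]]) (simp add: gf_def)
qed

lemma cylindric_partitions_has_sum_gf:
  "((\<lambda>\<Lambda>. (fps_X :: rat fps) ^ cylindric_size \<Lambda>) has_sum gf (cpairs d e)) (cylindric_partitions [d, e])"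
proof -
  have "((\<lambda>p. (fps_X :: rat fps) ^ pair_weight p) has_sum gf (cpairs d e)) (cpairs d e)"
  proof (rule has_sum_fpsI)
    fix n
    have eq: "{p \<in> cpairs d e. fps_nth ((fps_X :: rat fps) ^ pair_weight p) n \<noteq> 0} = {p \<in> cpairs d e. pair_weight p = n}"
      by auto
    show "finite {p \<in> cpairs d e. fps_nth ((fps_X :: rat fps) ^ pair_weight p) n \<noteq> 0}"
      unfolding eq by (rule finite_cpairs_weight)
    show "fps_nth (gf (cpairs d e)) n = (\<Sum>p | p \<in> cpairs d e \<and> fps_nth ((fps_X :: rat fps) ^ pair_weight p) n \<noteq> 0.
        fps_nth (fps_X ^ pair_weight p) n)"
      unfolding eq by (simp add: gf_def)
  qed
  also have "?this \<longleftrightarrow> ?thesis"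
  proof (rule has_sum_reindex_bij_witness[where i = "\<lambda>\<Lambda>. (\<Lambda> ! 0, \<Lambda> ! 1)" and j = "\<lambda>(l, m). [l, m]"])
    fix \<Lambda> assume "\<Lambda> \<in> cylindric_partitions [d, e]"
    then show "(case (\<Lambda> ! 0, \<Lambda> ! 1) of (l, m) \<Rightarrow> [l, m]) = \<Lambda>" "(\<Lambda> ! 0, \<Lambda> ! 1) \<in> cpairs d e"
      by (auto simp: cylindric_partitions_def cpairs_def numeral_2_eq_2 length_Suc_conv less_Suc_eq all_conj_distrib)
  qed (auto simp: cylindric_partitions_def cpairs_def less_Suc_eq all_conj_distrib
         cylindric_size_def pair_weight_def weight_def)
  finally show ?thesis .
qed

subsection \<open>The reflection solution of the recursion\<close>

text \<open>1 / (q;q)_m with the value 0 for negative \<open>m\<close>. Then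
  \<open>inv_qpoch_rec\<close> holds for all integers: for \<open>m \<le> 0\<close> the factor
  \<open>1 - q ^ nat m\<close> is 0.\<close>

definition inv_qpoch :: "rat fps \<Rightarrow> int \<Rightarrow> rat fps" where
  "inv_qpoch q m = (if m < 0 then 0 else inverse (qpoch q q (nat m)))"

lemma qpoch_inverse:
  assumes "fps_X dvd (q :: rat fps)"
  shows "inverse (qpoch q q n) * qpoch q q n = 1"
  by (rule inverse_mult_eq_1) (simp add: fps_nth_0_qpoch assms)

lemma inv_qpoch_rec:
  assumes "fps_X dvd q"
  shows "(1 - q ^ nat m) * inv_qpoch q m = inv_qpoch q (m - 1)"
proof (cases "m \<le> 0")
  case False
  then obtain k where k: "m = int (Suc k)"
    by (metis not_le zero_less_imp_eq_int gr0_implies_Suc)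
  define u v where "u = inverse (qpoch q q (Suc k))" and "v = inverse (qpoch q q k)"
  have uv: "u * (qpoch q q k * (1 - q ^ Suc k)) = 1" "v * qpoch q q k = 1"
    using qpoch_inverse[OF assms, of "Suc k"] qpoch_inverse[OF assms, of k]
    unfolding u_def v_def by (auto simp: qpoch_Suc)
  have "(1 - q ^ Suc k) * u = (v * qpoch q q k) * ((1 - q ^ Suc k) * u)"
    by (simp only: uv mult_1_left)
  also have "\<dots> = v * (u * (qpoch q q k * (1 - q ^ Suc k)))"
    by (simp only: mult_ac)
  finally have "(1 - q ^ Suc k) * u = v"
    by (simp only: uv mult_1_right)
  moreover have "nat m = Suc k" "nat (m - 1) = k" "\<not> m < 0" "\<not> m - 1 < 0"
    using k by auto
  ultimately show ?thesis
    by (simp add: inv_qpoch_def u_def v_def del: power_Suc)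
qed (auto simp: inv_qpoch_def)

abbreviation inv_qfact :: "int \<Rightarrow> rat fps" where
  "inv_qfact \<equiv> inv_qpoch fps_X"

lemmas inv_qfact_rec = inv_qpoch_rec[OF dvd_refl]

definition sign6 :: "int \<Rightarrow> rat fps" where
  "sign6 m = (if m mod 6 = 0 then 1 else if m mod 6 = 2 then -1 else 0)"

text \<open>
  The indices \<open>m \<equiv> 0, 2\<close> modulo 6 form the orbit of 0 under the reflections \<open>m \<mapsto> 2 - m\<close> and
  \<open>m \<mapsto> -4 - m\<close>, and the exponents make the wall conditions \<open>sieve_right\<close> and \<open>sieve_left\<close> antisymmetric
  under them. With \<open>m = 3n\<close> for even \<open>n\<close> and \<open>m = -1 - 3n\<close> for odd \<open>n\<close> the coefficient is
  \<open>(-1)^n q^(3n^2+n)\<close>, a term of the pentagonal number series in \<open>q^2\<close>.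
\<close>

definition pent_coeff :: "int \<Rightarrow> rat fps" where
  "pent_coeff m = sign6 m * fps_X ^ nat (m * (m + 1) div 3)"

definition summand :: "int \<Rightarrow> int \<Rightarrow> int \<Rightarrow> rat fps" where
  "summand a b m = pent_coeff m * inv_qfact (a + m) * inv_qfact (b - m)"

definition sieve :: "int \<Rightarrow> int \<Rightarrow> rat fps" where
  "sieve a b = (\<Sum>m=-a..b. summand a b m)"

text \<open>Outside \<open>{-a..b}\<close> one of the two \<open>inv_qfact\<close> has a negative
  index. Sums with different bounds can thus be compared over a common range.\<close>

lemma sieve_eq:
  assumes "finite M" "{-a..b} \<subseteq> M"
  shows "sieve a b = (\<Sum>m\<in>M. summand a b m)"
  unfolding sieve_def
  by (rule sum.mono_neutral_left) (use assms in \<open>auto simp: summand_def inv_qpoch_def\<close>)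

text \<open>With x = q^(a+m) and y = q^(b-m) this is 1 - xy = (1-x) + (1-y) - (1-x)(1-y). The
  product xy = q^(a+b) does not depend on \<open>m\<close>, so any linear combination satisfies the
  recursion.\<close>

lemma summand_rec:
  assumes "0 \<le> a + b" "m \<in> {-a..b}"
  shows "(1 - fps_X ^ nat (a + b)) * summand a b m =
    summand (a - 1) b m + summand a (b - 1) m - summand (a - 1) (b - 1) m"
proof -
  define i j where "i = a + m" and "j = b - m"
  have ij: "0 \<le> i" "0 \<le> j" using assms by (auto simp: i_def j_def)
  have "nat (a + b) = nat i + nat j"
    using ij by (simp add: i_def j_def flip: nat_add_distrib)
  then have q: "fps_X ^ nat (a + b) = (fps_X ^ nat i * fps_X ^ nat j :: rat fps)"
    by (simp add: power_add)
  have eqs: "a - 1 + m = i - 1" "b - 1 - m = j - 1"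
    by (auto simp: i_def j_def)
  show ?thesis
    unfolding summand_def eqs q i_def [symmetric] j_def [symmetric] inv_qfact_rec [symmetric]
    by (simp add: algebra_simps)
qed

lemma sieve_rec:
  assumes "0 \<le> a + b"
  shows "(1 - fps_X ^ nat (a + b)) * sieve a b =
    sieve (a - 1) b + sieve a (b - 1) - sieve (a - 1) (b - 1)"
proof -
  have sub: "sieve (a - 1) b = (\<Sum>m=-a..b. summand (a - 1) b m)"
    "sieve a (b - 1) = (\<Sum>m=-a..b. summand a (b - 1) m)"
    "sieve (a - 1) (b - 1) = (\<Sum>m=-a..b. summand (a - 1) (b - 1) m)"
    by (auto intro!: sieve_eq)
  have "sieve a b = (\<Sum>m=-a..b. summand a b m)"
    by (rule sieve_def)
  then show ?thesis
    using summand_rec[OF assms]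
    by (simp add: sub sum_distrib_left flip: sum.distrib sum_subtractf)
qed

lemma sum_antisymmetric:
  fixes f :: "int \<Rightarrow> rat fps"
  assumes "\<And>m. a \<le> m \<Longrightarrow> m \<le> b \<Longrightarrow> f (a + b - m) = - f m"
  shows "(\<Sum>m=a..b. f m) = 0"
proof -
  have "(\<Sum>m=a..b. f m) = (\<Sum>m=a..b. f (a + b - m))"
    by (rule sum.reindex_bij_witness[of _ "\<lambda>m. a + b - m" "\<lambda>m. a + b - m"]) auto
  also have "\<dots> = - (\<Sum>m=a..b. f m)"
    by (simp add: assms sum_negf)
  finally show ?thesis by simp
qed

lemma pent_exponent:
  assumes "m mod 6 = 0 \<or> m mod 6 = (2 :: int)"
  shows "3 * (m * (m + 1) div 3) = m * (m + 1)"
proof -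
  have "3 dvd m \<or> 3 dvd m + 1"
    using assms by presburger
  then have "3 dvd m * (m + 1)"
    by (auto intro: dvd_mult dvd_mult2)
  then show ?thesis by simp
qed

lemma pent_nonneg:
  "0 \<le> (m :: int) * (m + 1)"
  by (cases "0 \<le> m") (auto simp: zero_le_mult_iff)

text \<open>The reflection swaps the residues 0 and 2 modulo 6, hence the sign. It changes the
  exponent of \<open>pent_coeff\<close> by 2 - 2m and \<open>i - m\<close> by 2m - 2, which
  cancel.\<close>

lemma pent_coeff_reflect:
  assumes "m \<le> i" "2 - m \<le> i"
  shows "pent_coeff (2 - m) * fps_X ^ nat (i - (2 - m)) = - (pent_coeff m * fps_X ^ nat (i - m))"
proof (cases "m mod 6 = 0 \<or> m mod 6 = 2")
  case True
  then have m': "(2 - m) mod 6 = 0 \<or> (2 - m) mod 6 = 2" and "sign6 (2 - m) = - sign6 m"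
    by (auto simp: sign6_def) presburger+
  moreover have "nat ((2 - m) * (2 - m + 1) div 3) + nat (i - (2 - m)) = nat (m * (m + 1) div 3) + nat (i - m)"
  proof -
    \<comment> \<open>The factor 3 clears the \<open>div\<close>, which is exact for the admissible
      residues.\<close>
    have "3 * ((2 - m) * (2 - m + 1) div 3) = 3 * (m * (m + 1) div 3) - 6 * m + 6"
      unfolding pent_exponent[OF True] pent_exponent[OF m'] by (simp add: algebra_simps)
    then show ?thesis
      using assms pent_nonneg[of m] pent_nonneg[of "2 - m"]
      by (subst (1 2) nat_add_distrib [symmetric]) (auto simp: pos_imp_zdiv_nonneg_iff)
  qed
  ultimately show ?thesis
    by (simp add: pent_coeff_def mult.assoc flip: power_add)
next
  case False
  then have "sign6 m = 0" "sign6 (2 - m) = 0"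
    by (auto simp: sign6_def) presburger+
  then show ?thesis by (simp add: pent_coeff_def)
qed

text \<open>As for the other reflection; here the two exponents change by 2m + 4 and -2m -
  4.\<close>

lemma pent_coeff_reflect':
  assumes "- i \<le> m" "m \<le> i - 4"
  shows "pent_coeff (- 4 - m) * fps_X ^ nat (i + (- 4 - m)) = - (pent_coeff m * fps_X ^ nat (i + m))"
proof (cases "m mod 6 = 0 \<or> m mod 6 = 2")
  case True
  then have m': "(- 4 - m) mod 6 = 0 \<or> (- 4 - m) mod 6 = 2" and "sign6 (- 4 - m) = - sign6 m"
    by (auto simp: sign6_def) presburger+
  moreover have "nat ((- 4 - m) * (- 4 - m + 1) div 3) + nat (i + (- 4 - m)) = nat (m * (m + 1) div 3) + nat (i + m)"
  proof -
    have "3 * ((- 4 - m) * (- 4 - m + 1) div 3) = 3 * (m * (m + 1) div 3) + 6 * m + 12"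
      unfolding pent_exponent[OF True] pent_exponent[OF m'] by (simp add: algebra_simps)
    then show ?thesis
      using assms pent_nonneg[of m] pent_nonneg[of "- 4 - m"]
      by (subst (1 2) nat_add_distrib [symmetric]) (auto simp: pos_imp_zdiv_nonneg_iff)
  qed
  ultimately show ?thesis
    by (simp add: pent_coeff_def mult.assoc flip: power_add)
next
  case False
  then have "sign6 m = 0" "sign6 (- 4 - m) = 0"
    by (auto simp: sign6_def) presburger+
  then show ?thesis by (simp add: pent_coeff_def)
qed

lemma inv_qfact_diff:
  "inv_qfact m - inv_qfact (m - 1) = fps_X ^ nat m * inv_qfact m"
  unfolding inv_qfact_rec [symmetric] by (simp add: algebra_simps)

text \<open>By \<open>inv_qfact_diff\<close> the difference of the two sides is a sum of terms
  \<open>g m\<close>. The reflection \<open>m \<mapsto> -4 - m\<close> exchanges the two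
  \<open>inv_qfact\<close> and negates the rest, so the sum is 0.\<close>

lemma sieve_left: "sieve a (a - 4) = sieve (a - 1) (a - 4)"
proof -
  define g where "g m = pent_coeff m * fps_X ^ nat (a + m) * (inv_qfact (a + m) * inv_qfact (a - 4 - m))" for m
  have "sieve (a - 1) (a - 4) = (\<Sum>m=-a..a-4. summand (a - 1) (a - 4) m)"
    by (rule sieve_eq) auto
  then have "sieve a (a - 4) - sieve (a - 1) (a - 4) = (\<Sum>m=-a..a-4. summand a (a - 4) m - summand (a - 1) (a - 4) m)"
    by (simp add: sieve_def sum_subtractf)
  also have "\<dots> = (\<Sum>m=-a..a-4. g m)"
  proof (rule sum.cong)
    fix m
    have "a - 1 + m = a + m - 1" by simp
    then have "summand a (a - 4) m - summand (a - 1) (a - 4) m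
        = pent_coeff m * (inv_qfact (a + m) - inv_qfact (a + m - 1)) * inv_qfact (a - 4 - m)"
      by (simp add: summand_def algebra_simps)
    then show "summand a (a - 4) m - summand (a - 1) (a - 4) m = g m"
      by (simp add: inv_qfact_diff g_def mult.assoc)
  qed simp
  also have "\<dots> = 0"
  proof (rule sum_antisymmetric)
    fix m assume m: "- a \<le> m" "m \<le> a - 4"
    have eqs: "- a + (a - 4) - m = - 4 - m" "a + (- 4 - m) = a - 4 - m" "a - 4 - (- 4 - m) = a + m"
      by auto
    have "g (- 4 - m) = pent_coeff (- 4 - m) * fps_X ^ nat (a + (- 4 - m)) * (inv_qfact (a - 4 - m) * inv_qfact (a + m))"
      unfolding g_def eqs ..
    then show "g (- a + (a - 4) - m) = - g m"
      unfolding eqs(1) pent_coeff_reflect'[OF m] by (simp add: g_def mult.commute)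
  qed
  finally show ?thesis by simp
qed

text \<open>The same cancellation in the second index, now under
  \<open>m \<mapsto> 2 - m\<close>.\<close>

lemma sieve_right: "sieve (b - 2) b = sieve (b - 2) (b - 1)"
proof -
  define g where "g m = pent_coeff m * fps_X ^ nat (b - m) * (inv_qfact (b - 2 + m) * inv_qfact (b - m))" for m
  have "sieve (b - 2) (b - 1) = (\<Sum>m=-(b-2)..b. summand (b - 2) (b - 1) m)"
    by (rule sieve_eq) auto
  then have "sieve (b - 2) b - sieve (b - 2) (b - 1) = (\<Sum>m=-(b-2)..b. summand (b - 2) b m - summand (b - 2) (b - 1) m)"
    by (simp add: sieve_def sum_subtractf)
  also have "\<dots> = (\<Sum>m=-(b-2)..b. g m)"
  proof (rule sum.cong)
    fix m
    have "b - 1 - m = b - m - 1" by simp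
    then have "summand (b - 2) b m - summand (b - 2) (b - 1) m
        = pent_coeff m * inv_qfact (b - 2 + m) * (inv_qfact (b - m) - inv_qfact (b - m - 1))"
      by (simp add: summand_def algebra_simps)
    then show "summand (b - 2) b m - summand (b - 2) (b - 1) m = g m"
      by (simp add: inv_qfact_diff g_def mult_ac)
  qed simp
  also have "\<dots> = 0"
  proof (rule sum_antisymmetric)
    fix m assume m: "- (b - 2) \<le> m" "m \<le> b"
    have eqs: "- (b - 2) + b - m = 2 - m" "b - 2 + (2 - m) = b - m" "b - (2 - m) = b - 2 + m"
      by auto
    have "g (2 - m) = pent_coeff (2 - m) * fps_X ^ nat (b - (2 - m)) * (inv_qfact (b - m) * inv_qfact (b - 2 + m))"
      unfolding g_def eqs ..
    moreover have "pent_coeff (2 - m) * fps_X ^ nat (b - (2 - m)) = - (pent_coeff m * fps_X ^ nat (b - m))"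
      by (rule pent_coeff_reflect) (use m in auto)
    ultimately show "g (- (b - 2) + b - m) = - g m"
      unfolding eqs(1) by (simp add: g_def mult.commute)
  qed
  finally show ?thesis by simp
qed

lemma sieve_outside:
  assumes "a < 0 \<or> b < 0" "a - b \<le> 3" "b - a \<le> 1"
  shows "sieve a b = 0"
  unfolding sieve_def
proof (rule sum.neutral, rule ballI)
  fix m assume "m \<in> {-a..b}"
  \<comment> \<open>For \<open>a < 0\<close> the range is empty. For \<open>b < 0\<close> the strip
    forces \<open>a \<le> 2\<close>, leaving residues 5 and 4 modulo 6, where \<open>sign6\<close>
    is 0.\<close>
  then have "m = -1 \<or> m = -2"
    using assms by auto
  then show "summand a b m = 0"
    by (auto simp: summand_def pent_coeff_def sign6_def)
qed

lemma sieve_00: "sieve 0 0 = 1"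
  by (simp add: sieve_def summand_def pent_coeff_def sign6_def inv_qpoch_def)

subsection \<open>Identities of Euler\<close>

lemma fps_X_power_dvd_le:
  "fps_X ^ n dvd f \<Longrightarrow> m \<le> n \<Longrightarrow> fps_X ^ m dvd (f :: 'a :: comm_ring_1 fps)"
  using dvd_trans le_imp_power_dvd by blast

lemma qpoch_inf_inverse_approx:
  assumes "fps_X dvd (q :: rat fps)" "0 \<le> k"
  shows "fps_X ^ nat k dvd qpoch_inf q q * inv_qpoch q k - 1"
proof -
  have "qpoch_inf q q * inv_qpoch q k - 1 = (qpoch_inf q q - qpoch q q (nat k)) * inv_qpoch q k"
    using qpoch_inverse[OF assms(1), of "nat k"] assms(2)
    by (simp add: inv_qpoch_def algebra_simps)
  moreover have "fps_X ^ Suc (nat k) dvd qpoch_inf q q - qpoch q q (nat k)"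
    by (rule qpoch_inf_approx) (use assms in auto)
  then have "fps_X ^ nat k dvd qpoch_inf q q - qpoch q q (nat k)"
    by (rule fps_X_power_dvd_le) simp
  ultimately show ?thesis
    by (simp add: dvd_mult2)
qed

lemma pent_coeff_dvd: "fps_X ^ nat \<bar>m\<bar> dvd pent_coeff m"
proof (cases "m mod 6 = 0 \<or> m mod 6 = 2")
  case True
  have "3 * \<bar>m\<bar> \<le> m * (m + 1)"
  proof (cases "2 \<le> m")
    case True
    then have "m * 3 \<le> m * (m + 1)" by (intro mult_left_mono) auto
    with True show ?thesis by simp
  next
    case False
    \<comment> \<open>The nonzero indices from -3 to 1, where the bound could fail, have residues
      other than 0 and 2.\<close>
    with \<open>m mod 6 = 0 \<or> m mod 6 = 2\<close> have "m = 0 \<or> m \<le> -4" by presburger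
    then show ?thesis
    proof
      assume "m \<le> -4"
      then have "(-m) * 3 \<le> (-m) * (-m - 1)" by (intro mult_left_mono) auto
      with \<open>m \<le> -4\<close> show ?thesis by (simp add: algebra_simps)
    qed simp
  qed
  with pent_exponent[OF True] have "nat \<bar>m\<bar> \<le> nat (m * (m + 1) div 3)" by linarith
  then show ?thesis
    unfolding pent_coeff_def by (intro dvd_mult le_imp_power_dvd)
qed (simp add: pent_coeff_def sign6_def)

text \<open>\<open>pent_coeff m\<close> contributes |m| powers of q, and both normalised reciprocals
  \<open>u\<close> and \<open>v\<close> are 1 up to order n - |m|, since their indices are at least
  that; together this makes \<open>n\<close>.\<close>

lemma sieve_diag_approx:
  "fps_X ^ n dvd sieve (int n) (int n) * (qpoch_inf fps_X fps_X)\<^sup>2 - (\<Sum>m=-int n..int n. pent_coeff m)"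
proof -
  let ?P = "qpoch_inf fps_X fps_X :: rat fps"
  have "fps_X ^ n dvd summand (int n) (int n) m * ?P\<^sup>2 - pent_coeff m" if m: "m \<in> {-int n..int n}" for m
  proof -
    define u v where "u = ?P * inv_qfact (int n + m)" and "v = ?P * inv_qfact (int n - m)"
    define k where "k = nat (int n - \<bar>m\<bar>)"
    have "fps_X ^ k dvd u - 1" "fps_X ^ k dvd v - 1"
      using m unfolding u_def v_def
      by (auto simp: k_def intro!: fps_X_power_dvd_le[OF qpoch_inf_inverse_approx])
    then have "fps_X ^ k dvd (u - 1) * v + (v - 1)"
      by (intro dvd_add dvd_mult2)
    then have "fps_X ^ nat \<bar>m\<bar> * fps_X ^ k dvd pent_coeff m * ((u - 1) * v + (v - 1))"
      by (intro mult_dvd_mono pent_coeff_dvd)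
    moreover have "nat \<bar>m\<bar> + k = n"
      using m by (auto simp: k_def)
    moreover have "pent_coeff m * ((u - 1) * v + (v - 1)) = summand (int n) (int n) m * ?P\<^sup>2 - pent_coeff m"
      by (simp add: u_def v_def summand_def power2_eq_square algebra_simps)
    ultimately show ?thesis
      by (simp flip: power_add)
  qed
  then have "fps_X ^ n dvd (\<Sum>m=-int n..int n. summand (int n) (int n) m * ?P\<^sup>2 - pent_coeff m)"
    by (intro dvd_sum) auto
  then show ?thesis
    by (simp add: sieve_def sum_subtractf sum_distrib_right)
qed

section \<open>Euler's sum as a limit of the finite q-binomial theorem\<close>

lemma qpoch_approx:
  assumes "fps_X dvd a" "fps_X dvd (q :: 'a :: comm_ring_1 fps)" "m \<le> n"
  shows "fps_X ^ Suc m dvd qpoch a q n - qpoch a q m"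
proof -
  have "fps_X ^ Suc m dvd qpoch_inf a q - qpoch a q m"
    by (rule qpoch_inf_approx[OF assms(1,2)])
  moreover have "fps_X ^ Suc m dvd qpoch_inf a q - qpoch a q n"
    by (rule fps_X_power_dvd_le[OF qpoch_inf_approx[OF assms(1,2)]]) (use assms(3) in simp)
  ultimately have "fps_X ^ Suc m dvd (qpoch_inf a q - qpoch a q m) - (qpoch_inf a q - qpoch a q n)"
    by (rule dvd_diff)
  then show ?thesis by simp
qed

text \<open>The integer \<open>k\<close> lets the coefficient vanish outside 0..n through
  \<open>inv_qpoch\<close>, so that the Pascal rule has no boundary cases.\<close>

definition gauss_binom :: "rat fps \<Rightarrow> nat \<Rightarrow> int \<Rightarrow> rat fps" where
  "gauss_binom q n k = qpoch q q n * inv_qpoch q k * inv_qpoch q (int n - k)"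

text \<open>With x = q^k and y = q^(n+1-k) this is 1 - xy = (1-y) + y(1-x).\<close>

lemma gauss_binom_Suc:
  assumes "fps_X dvd q" "0 \<le> k" "k \<le> int (Suc n)"
  shows "gauss_binom q (Suc n) k = gauss_binom q n k + q ^ nat (int (Suc n) - k) * gauss_binom q n (k - 1)"
proof -
  define i j where "i = inv_qpoch q k" and "j = inv_qpoch q (int (Suc n) - k)"
  have "nat k + nat (int (Suc n) - k) = Suc n" using assms by simp
  then have q: "q ^ Suc n = q ^ nat k * q ^ nat (int (Suc n) - k)"
    by (metis power_add)
  have eqs: "int n - k = int (Suc n) - k - 1" "int n - (k - 1) = int (Suc n) - k"
    by auto
  have 1: "gauss_binom q (Suc n) k = qpoch q q n * (1 - q ^ Suc n) * i * j"
    unfolding gauss_binom_def qpoch_Suc i_def j_def by simp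
  have 2: "gauss_binom q n k = qpoch q q n * i * ((1 - q ^ nat (int (Suc n) - k)) * j)"
    unfolding gauss_binom_def eqs i_def j_def inv_qpoch_rec[OF assms(1)] ..
  have 3: "gauss_binom q n (k - 1) = qpoch q q n * ((1 - q ^ nat k) * i) * j"
    unfolding gauss_binom_def eqs i_def j_def inv_qpoch_rec[OF assms(1)] ..
  show ?thesis
    unfolding 1 2 3 q by (simp add: algebra_simps)
qed

abbreviation X2 :: "rat fps" where "X2 \<equiv> fps_X\<^sup>2"

lemma X_dvd_X2 [simp]: "fps_X dvd X2"
  by (simp add: power2_eq_square)

lemma qpoch_gauss_sum:
  "(\<Sum>k\<le>n. fps_X ^ (k\<^sup>2) * gauss_binom X2 n (int k)) = qpoch (- fps_X) X2 n"
proof (induction n)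
  case 0
  show ?case by (simp add: gauss_binom_def inv_qpoch_def)
next
  case (Suc n)
  have step: "fps_X ^ (k\<^sup>2) * gauss_binom X2 (Suc n) (int k) = fps_X ^ (k\<^sup>2) * gauss_binom X2 n (int k) +
      fps_X ^ (k\<^sup>2 + 2 * (Suc n - k)) * gauss_binom X2 n (int k - 1)" if "k \<le> Suc n" for k
  proof -
    have "nat (int (Suc n) - int k) = Suc n - k" by simp
    then have "gauss_binom X2 (Suc n) (int k) = gauss_binom X2 n (int k) + X2 ^ (Suc n - k) * gauss_binom X2 n (int k - 1)"
      using gauss_binom_Suc[of X2 "int k" n] that by (simp del: power_Suc of_nat_Suc)
    then show ?thesis
      by (simp only: power_add power_mult distrib_left mult.assoc)
  qed
  have "(\<Sum>k\<le>Suc n. fps_X ^ (k\<^sup>2) * gauss_binom X2 (Suc n) (int k)) =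
      (\<Sum>k\<le>Suc n. fps_X ^ (k\<^sup>2) * gauss_binom X2 n (int k)) +
      (\<Sum>k\<le>Suc n. fps_X ^ (k\<^sup>2 + 2 * (Suc n - k)) * gauss_binom X2 n (int k - 1))"
    unfolding sum.distrib [symmetric] by (intro sum.cong refl step) simp
  also have "(\<Sum>k\<le>Suc n. fps_X ^ (k\<^sup>2) * gauss_binom X2 n (int k)) = qpoch (- fps_X) X2 n"
    unfolding sum.atMost_Suc Suc.IH by (simp add: gauss_binom_def inv_qpoch_def)
  \<comment> \<open>The term \<open>k = 0\<close> drops out because its Gaussian coefficient has
    lower index -1. After the shift, q^(2n+1) factors out, which is the missing part of the new
    factor of the product.\<close>
  also have "(\<Sum>k\<le>Suc n. fps_X ^ (k\<^sup>2 + 2 * (Suc n - k)) * gauss_binom X2 n (int k - 1)) =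
      (\<Sum>k\<le>n. fps_X ^ ((Suc k)\<^sup>2 + 2 * (n - k)) * gauss_binom X2 n (int k))"
    unfolding sum.atMost_Suc_shift by (simp add: gauss_binom_def inv_qpoch_def)
  also have "\<dots> = (\<Sum>k\<le>n. fps_X ^ (2 * n + 1) * (fps_X ^ (k\<^sup>2) * gauss_binom X2 n (int k)))"
  proof (rule sum.cong)
    fix k assume "k \<in> {..n}"
    then have "(Suc k)\<^sup>2 + 2 * (n - k) = 2 * n + 1 + k\<^sup>2"
      by (simp add: power2_eq_square)
    then show "fps_X ^ ((Suc k)\<^sup>2 + 2 * (n - k)) * gauss_binom X2 n (int k) =
        fps_X ^ (2 * n + 1) * (fps_X ^ (k\<^sup>2) * gauss_binom X2 n (int k))"
      by (simp only: power_add mult.assoc)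
  qed simp
  also have "\<dots> = fps_X ^ (2 * n + 1) * qpoch (- fps_X) X2 n"
    by (simp add: sum_distrib_left [symmetric] Suc.IH)
  also have "qpoch (- fps_X) X2 n + fps_X ^ (2 * n + 1) * qpoch (- fps_X) X2 n = qpoch (- fps_X) X2 (Suc n)"
  proof -
    have "fps_X ^ (2 * n + 1) = fps_X * X2 ^ n"
      by (simp add: power_mult)
    moreover have "a + x * y * a = a * (1 - (- x) * y)" for a x y :: "rat fps"
      by (simp add: algebra_simps)
    ultimately show ?thesis
      unfolding qpoch_Suc by simp
  qed
  finally show ?case .
qed

text \<open>In the finite identity the coefficient of q^(k^2) differs from 1 / (q^2;q^2)_k only from
  order n - k on, and q^(k^2) supplies the other \<open>k\<close> powers.\<close>

lemma euler_sum:
  "(\<lambda>n. fps_X ^ (n\<^sup>2) / qpoch X2 X2 n) sums qpoch_inf (- fps_X) X2"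
  unfolding sums_def_le
proof (rule tendsto_fps_X_power_dvd)
  show "qpoch (- fps_X) X2 \<longlonglongrightarrow> qpoch_inf (- fps_X) X2"
    by (rule qpoch_tendsto_inf) auto
  fix n
  have "fps_X ^ n dvd fps_X ^ (k\<^sup>2) * gauss_binom X2 n (int k) - fps_X ^ (k\<^sup>2) / qpoch X2 X2 k" if "k \<le> n" for k
  proof -
    define u where "u = inverse (qpoch X2 X2 (n - k))"
    have "fps_X ^ Suc (n - k) dvd qpoch X2 X2 n - qpoch X2 X2 (n - k)"
      by (rule qpoch_approx) auto
    then have "fps_X ^ (n - k) dvd qpoch X2 X2 n - qpoch X2 X2 (n - k)"
      by (rule fps_X_power_dvd_le) simp
    then have "fps_X ^ (n - k) dvd (qpoch X2 X2 n - qpoch X2 X2 (n - k)) * (u * inverse (qpoch X2 X2 k))"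
      by (rule dvd_mult2)
    then have "fps_X ^ k * fps_X ^ (n - k) dvd
        fps_X ^ (k\<^sup>2) * ((qpoch X2 X2 n - qpoch X2 X2 (n - k)) * (u * inverse (qpoch X2 X2 k)))"
      by (intro mult_dvd_mono le_imp_power_dvd) (auto simp: power2_eq_square)
    moreover have "u * qpoch X2 X2 (n - k) = 1"
      unfolding u_def by (rule qpoch_inverse) simp
    then have "(qpoch X2 X2 n - qpoch X2 X2 (n - k)) * (u * inverse (qpoch X2 X2 k)) =
        gauss_binom X2 n (int k) - inverse (qpoch X2 X2 k)"
      using that by (simp add: gauss_binom_def inv_qpoch_def u_def nat_diff_distrib algebra_simps)
    moreover have "fps_X ^ (k\<^sup>2) / qpoch X2 X2 k = fps_X ^ (k\<^sup>2) * inverse (qpoch X2 X2 k)"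
      by (rule fps_divide_unit) (simp add: fps_nth_0_qpoch)
    ultimately show ?thesis
      using that by (simp add: right_diff_distrib flip: power_add)
  qed
  then show "fps_X ^ n dvd qpoch (- fps_X) X2 n - (\<Sum>k\<le>n. fps_X ^ (k\<^sup>2) / qpoch X2 X2 k)"
    unfolding qpoch_gauss_sum [symmetric] sum_subtractf [symmetric]
    by (intro dvd_sum) auto
qed

section \<open>The pentagonal number theorem in base q^2\<close>

definition pent_sum :: "nat \<Rightarrow> rat fps" where
  "pent_sum n = 1 + (\<Sum>k=1..n. (-1) ^ k * (fps_X ^ (k * (3 * k + 1)) + fps_X ^ (k * (3 * k - 1))))"

lemma pent_sum_Suc:
  "pent_sum (Suc n) = pent_sum n +
    (-1) ^ Suc n * (fps_X ^ (Suc n * (3 * Suc n + 1)) + fps_X ^ (Suc n * (3 * Suc n - 1)))"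
  unfolding pent_sum_def sum.cl_ivl_Suc by (simp only: add.assoc) simp

text \<open>Summands of Shanks' finite form of the pentagonal number theorem, with base \<open>q^2\<close>.\<close>

definition shanks :: "nat \<Rightarrow> nat \<Rightarrow> rat fps" where
  "shanks n s = (-1) ^ s * fps_X ^ (2 * (s * n) + s * (s + 1)) * (qpoch X2 X2 n * inverse (qpoch X2 X2 s))"

lemma shanks_Suc: "shanks (Suc n) s = shanks n s * (fps_X ^ (2 * s) * (1 - fps_X ^ (2 * Suc n)))"
proof -
  have "2 * (s * Suc n) + s * (s + 1) = (2 * (s * n) + s * (s + 1)) + 2 * s"
    by simp
  moreover have "X2 * X2 ^ n = fps_X ^ (2 * Suc n)"
    by (simp only: power_mult power_Suc)
  ultimately show ?thesis
    unfolding shanks_def qpoch_Suc by (simp only: power_add mult_ac)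
qed

lemma shanks_step: "shanks n (Suc s) * (1 - fps_X ^ (2 * Suc s)) = - shanks n s * fps_X ^ (2 * (s + n + 1))"
proof -
  have "inv_qpoch X2 (int (Suc s)) * (1 - X2 ^ Suc s) = inv_qpoch X2 (int s)"
    using inv_qpoch_rec[of X2 "int (Suc s)"] by (simp add: mult.commute del: power_Suc of_nat_Suc)
      (simp add: nat_int del: power_Suc)
  then have "inverse (qpoch X2 X2 (Suc s)) * (1 - X2 ^ Suc s) = inverse (qpoch X2 X2 s)"
    by (simp add: inv_qpoch_def nat_add_distrib del: power_Suc)
  then have "inverse (qpoch X2 X2 (Suc s)) * (1 - fps_X ^ (2 * Suc s)) = inverse (qpoch X2 X2 s)"
    by (simp only: power_mult)
  then have "shanks n (Suc s) * (1 - fps_X ^ (2 * Suc s)) =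
      (-1) ^ Suc s * fps_X ^ (2 * (Suc s * n) + Suc s * (Suc s + 1)) * (qpoch X2 X2 n * inverse (qpoch X2 X2 s))"
    unfolding shanks_def by (simp only: mult.assoc)
  moreover have "2 * (Suc s * n) + Suc s * (Suc s + 1) = 2 * (s * n) + s * (s + 1) + 2 * (s + n + 1)"
    by simp
  ultimately show ?thesis
    unfolding shanks_def by (simp only: power_add power_Suc mult_ac) simp
qed

text \<open>By \<open>shanks_Suc\<close> each difference splits into two parts; by
  \<open>shanks_step\<close> the first cancels the boundary term left by the preceding
  index.\<close>

lemma shanks_telescope:
  "(\<Sum>s\<le>m. shanks (Suc n) s - shanks n s) = - shanks n m * fps_X ^ (2 * (m + n + 1))"
proof (induction m)
  case 0
  show ?case unfolding shanks_Suc by (simp add: algebra_simps)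
next
  case (Suc m)
  have "shanks (Suc n) (Suc m) - shanks n (Suc m) =
     - (shanks n (Suc m) * (1 - fps_X ^ (2 * Suc m))) - shanks n (Suc m) * fps_X ^ (2 * (Suc m + n + 1))"
    unfolding shanks_Suc by (simp add: algebra_simps power_add power_mult)
  then show ?case
    unfolding sum.atMost_Suc Suc.IH shanks_step by simp
qed

text \<open>From \<open>n\<close> to \<open>n + 1\<close> the sum gains the telescoped boundary term
  and the new diagonal term \<open>s = n + 1\<close>. These are the two pentagonal terms of index
  \<open>n + 1\<close>.\<close>

lemma shanks_pent_sum: "(\<Sum>s\<le>n. shanks n s) = pent_sum n"
proof (induction n)
  case 0
  show ?case by (simp add: shanks_def pent_sum_def)
next
  case (Suc n)
  have diag: "shanks k k = (-1) ^ k * fps_X ^ (k * (3 * k + 1))" for k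
  proof -
    have "2 * (k * k) + k * (k + 1) = k * (3 * k + 1)" by (simp add: algebra_simps)
    moreover have "qpoch X2 X2 k * inverse (qpoch X2 X2 k) = 1"
      using qpoch_inverse[of X2 k] by (simp add: mult.commute)
    ultimately show ?thesis by (simp add: shanks_def)
  qed
  have "(\<Sum>s\<le>Suc n. shanks (Suc n) s) = (\<Sum>s\<le>n. shanks n s) + (\<Sum>s\<le>n. shanks (Suc n) s - shanks n s) + shanks (Suc n) (Suc n)"
    by (simp add: sum_subtractf)
  also have "\<dots> = pent_sum n - shanks n n * fps_X ^ (2 * (n + n + 1)) + shanks (Suc n) (Suc n)"
    unfolding Suc.IH shanks_telescope by simp
  also have "shanks n n * fps_X ^ (2 * (n + n + 1)) = (-1) ^ n * fps_X ^ (Suc n * (3 * Suc n - 1))"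
  proof -
    have "n * (3 * n + 1) + 2 * (n + n + 1) = Suc n * (3 * Suc n - 1)" by (simp add: algebra_simps)
    then show ?thesis unfolding diag by (simp only: mult.assoc flip: power_add)
  qed
  also have "pent_sum n - (-1) ^ n * fps_X ^ (Suc n * (3 * Suc n - 1)) + shanks (Suc n) (Suc n) = pent_sum (Suc n)"
    unfolding diag pent_sum_def sum.cl_ivl_Suc by (simp add: algebra_simps)
  finally show ?case .
qed

text \<open>The term \<open>s = 0\<close> of Shanks' sum is the product itself; every other term has
  exponent at least \<open>2 * n\<close>.\<close>

lemma pent_sum_approx: "fps_X ^ n dvd pent_sum n - qpoch X2 X2 n"
proof -
  have "pent_sum n - qpoch X2 X2 n = (\<Sum>s\<in>{..n} - {0}. shanks n s)"
    unfolding shanks_pent_sum [symmetric]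
    by (simp add: sum.remove[of "{..n}" 0] shanks_def)
  also have "fps_X ^ n dvd \<dots>"
  proof (rule dvd_sum)
    fix s assume "s \<in> {..n} - {0}"
    then have "n \<le> 2 * (s * n) + s * (s + 1)"
      by (cases s) auto
    then show "fps_X ^ n dvd shanks n s"
      unfolding shanks_def by (intro dvd_mult dvd_mult2 le_imp_power_dvd)
  qed
  finally show ?thesis .
qed

lemma sum_symmetric_Suc:
  fixes f :: "int \<Rightarrow> 'a :: comm_monoid_add"
  shows "(\<Sum>m=-int (Suc n)..int (Suc n). f m) = (\<Sum>m=-int n..int n. f m) + (f (int (Suc n)) + f (- int (Suc n)))"
proof -
  have "{-int (Suc n)..int (Suc n)} = insert (int (Suc n)) (insert (- int (Suc n)) {-int n..int n})"
    by auto
  then show ?thesis by (simp add: add_ac)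
qed

text \<open>Enlarging the range by a full period of 6 on both sides adds four nonzero terms: 6k+2
  and -6k-4 give the pentagonal pair of index 2k+1, and 6k+6 and -6k-6 that of index 2k+2.\<close>

lemma pent_coeff_sum: "(\<Sum>m=-int (6 * k)..int (6 * k). pent_coeff m) = pent_sum (2 * k)"
proof (induction k)
  case 0
  show ?case by (simp add: pent_coeff_def sign6_def pent_sum_def)
next
  case (Suc k)
  let ?k = "6 * int k"
  have zero: "pent_coeff m = 0" if "m mod 6 \<noteq> 0" "m mod 6 \<noteq> 2" for m
    using that by (simp add: pent_coeff_def sign6_def)
  have zeros: "pent_coeff (?k + 1) = 0" "pent_coeff (- ?k - 1) = 0" "pent_coeff (- ?k - 2) = 0"
    "pent_coeff (?k + 3) = 0" "pent_coeff (- ?k - 3) = 0" "pent_coeff (?k + 4) = 0"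
    "pent_coeff (?k + 5) = 0" "pent_coeff (- ?k - 5) = 0"
    by (rule zero; presburger)+
  have minus: "pent_coeff m = - (fps_X ^ n)" if "m mod 6 = 2" "m * (m + 1) = 3 * int n" for m n
    using that by (simp add: pent_coeff_def sign6_def)
  have "pent_coeff (?k + 2) = - (fps_X ^ (Suc (2 * k) * (6 * k + 2)))"
    "pent_coeff (- ?k - 4) = - (fps_X ^ (Suc (2 * k) * (6 * k + 4)))"
    by (rule minus; (presburger | simp add: algebra_simps))+
  note minuses = this
  have plus: "pent_coeff m = fps_X ^ n" if "m mod 6 = 0" "m * (m + 1) = 3 * int n" for m n
    using that by (simp add: pent_coeff_def sign6_def)
  have "pent_coeff (?k + 6) = fps_X ^ (Suc (Suc (2 * k)) * (6 * k + 7))"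
    "pent_coeff (- ?k - 6) = fps_X ^ (Suc (Suc (2 * k)) * (6 * k + 5))"
    by (rule plus; (presburger | simp add: algebra_simps))+
  note vals = zeros minuses this
  have ints: "int (Suc (6 * k)) = ?k + 1" "int (Suc (Suc (6 * k))) = ?k + 2"
    "int (Suc (Suc (Suc (6 * k)))) = ?k + 3" "int (Suc (Suc (Suc (Suc (6 * k))))) = ?k + 4"
    "int (Suc (Suc (Suc (Suc (Suc (6 * k)))))) = ?k + 5"
    "int (Suc (Suc (Suc (Suc (Suc (Suc (6 * k))))))) = ?k + 6"
    by auto
  have suc6: "6 * Suc k = Suc (Suc (Suc (Suc (Suc (Suc (6 * k))))))" by simp
  have "(\<Sum>m=-int (6 * Suc k)..int (6 * Suc k). pent_coeff m) = pent_sum (2 * k) +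
     ((pent_coeff (?k + 1) + pent_coeff (- ?k - 1)) + (pent_coeff (?k + 2) + pent_coeff (- ?k - 2)) +
     (pent_coeff (?k + 3) + pent_coeff (- ?k - 3)) + (pent_coeff (?k + 4) + pent_coeff (- ?k - 4)) +
     (pent_coeff (?k + 5) + pent_coeff (- ?k - 5)) + (pent_coeff (?k + 6) + pent_coeff (- ?k - 6)))"
    unfolding suc6 sum_symmetric_Suc Suc.IH unfolding ints
    by (simp only: add.assoc minus_add_distrib diff_conv_add_uminus)
  also have "\<dots> = pent_sum (2 * Suc k)"
  proof -
    have suc2: "2 * Suc k = Suc (Suc (2 * k))" by simp
    have args: "3 * Suc (2 * k) + 1 = 6 * k + 4" "3 * Suc (2 * k) - 1 = 6 * k + 2"
      "3 * Suc (Suc (2 * k)) + 1 = 6 * k + 7" "3 * Suc (Suc (2 * k)) - 1 = 6 * k + 5"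
      by auto
    have signs: "(-1) ^ Suc (2 * k) = (-1 :: rat fps)" "(-1) ^ Suc (Suc (2 * k)) = (1 :: rat fps)"
      by simp_all
    have "p + (0 + 0 + (- a + 0) + (0 + 0) + (0 + - b) + (0 + 0) + (c + d)) = p + -1 * (b + a) + 1 * (c + d)"
      for p a b c d :: "rat fps"
      by simp
    then show ?thesis
      unfolding suc2 pent_sum_Suc args signs vals .
  qed
  finally show ?case .
qed

subsection \<open>Profile (3,1)\<close>

lemma one_minus_fps_X_power_nonzero:
  assumes "0 < n"
  shows "1 - fps_X ^ n \<noteq> (0 :: rat fps)"
proof -
  have "fps_nth (1 - fps_X ^ n :: rat fps) 0 = 1"
    using assms by simp
  then show ?thesis
    by (metis fps_zero_nth zero_neq_one)
qed

text \<open>Both sides satisfy the same recursion. A neighbour leaves the strip only at a wall,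
  where the wall condition replaces it by \<open>(a - 1, b - 1)\<close>, again in the strip and with
  smaller sum.\<close>

lemma gf_bounded_eq_sieve:
  assumes "a - b \<le> 3" "b - a \<le> 1"
  shows "gf (bounded_cpairs 3 1 a b) = sieve a b"
  using assms
proof (induction "nat (a + b)" arbitrary: a b rule: less_induct)
  case less
  let ?g = "\<lambda>a b. gf (bounded_cpairs 3 1 a b)"
  show ?case
  proof (cases "a < 0 \<or> b < 0 \<or> a = 0 \<and> b = 0")
    case True
    then show ?thesis
      using bounded_cpairs_empty[of a b] sieve_outside[OF _ less.prems] gf_bounded_00 sieve_00 by auto
  next
    case False
    then have pos: "0 \<le> a" "0 \<le> b" "0 < a + b" by auto
    have diag: "?g (a - 1) (b - 1) = sieve (a - 1) (b - 1)"
      by (rule less.hyps) (use pos less.prems in auto)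
    have left: "?g (a - 1) b = sieve (a - 1) b"
    proof (cases "b - a = 1")
      case True
      then have "?g (a - 1) b = ?g (a - 1) (b - 1)" "sieve (a - 1) b = sieve (a - 1) (b - 1)"
        using bounded_cpairs_right[of 3 1 b] sieve_right[of b] by (simp_all add: algebra_simps)
      with diag show ?thesis by simp
    next
      case False
      show ?thesis by (rule less.hyps) (use pos less.prems False in auto)
    qed
    have right: "?g a (b - 1) = sieve a (b - 1)"
    proof (cases "a - b = 3")
      case True
      then have b: "b - 1 = a - 4" by simp
      have "?g a (b - 1) = ?g (a - 1) (b - 1)" "sieve a (b - 1) = sieve (a - 1) (b - 1)"
        unfolding b using bounded_cpairs_left[of 3 1 a] sieve_left[of a] by simp_all
      with diag show ?thesis by simp
    next
      case False
      show ?thesis by (rule less.hyps) (use pos less.prems False in auto)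
    qed
    have "(1 - fps_X ^ nat (a + b)) * ?g a b = ?g (a - 1) b + ?g a (b - 1) - ?g (a - 1) (b - 1)"
      by (rule gf_bounded_rec) (use pos less.prems in auto)
    also have "\<dots> = (1 - fps_X ^ nat (a + b)) * sieve a b"
      unfolding diag left right by (rule sieve_rec [symmetric]) (use pos in simp)
    finally show ?thesis
      using one_minus_fps_X_power_nonzero[of "nat (a + b)"] pos by simp
  qed
qed

lemma gf_cpairs_eq: "gf (cpairs 3 1) * (qpoch_inf fps_X fps_X)\<^sup>2 = qpoch_inf X2 X2"
proof -
  let ?P = "qpoch_inf fps_X fps_X :: rat fps"
  define f where "f k = sieve (int (6 * k)) (int (6 * k)) * ?P\<^sup>2" for k
  have "gf (bounded_cpairs 3 1 (int n) (int n)) = sieve (int n) (int n)" for n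
    by (rule gf_bounded_eq_sieve) auto
  then have "(\<lambda>n. sieve (int n) (int n)) \<longlonglongrightarrow> gf (cpairs 3 1)"
    using gf_bounded_tendsto[of 3 1] by (simp only:)
  \<comment> \<open>Bounds divisible by 6 are those at which \<open>pent_coeff_sum\<close> evaluates
    the coefficient sum.\<close>
  then have "((\<lambda>n. sieve (int n) (int n)) \<circ> (\<lambda>k. 6 * k)) \<longlonglongrightarrow> gf (cpairs 3 1)"
    by (rule LIMSEQ_subseq_LIMSEQ) (simp add: strict_mono_def)
  then have "f \<longlonglongrightarrow> gf (cpairs 3 1) * ?P\<^sup>2"
    unfolding f_def by (intro tendsto_mult_fps tendsto_const) (simp add: o_def)
  moreover have "fps_X ^ k dvd f k - qpoch X2 X2 (2 * k)" for k
  proof -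
    have "fps_X ^ k dvd f k - pent_sum (2 * k)"
      unfolding f_def pent_coeff_sum [symmetric]
      by (rule fps_X_power_dvd_le[OF sieve_diag_approx]) simp
    moreover have "fps_X ^ k dvd pent_sum (2 * k) - qpoch X2 X2 (2 * k)"
      by (rule fps_X_power_dvd_le[OF pent_sum_approx]) simp
    ultimately have "fps_X ^ k dvd (f k - pent_sum (2 * k)) + (pent_sum (2 * k) - qpoch X2 X2 (2 * k))"
      by (rule dvd_add)
    then show ?thesis by simp
  qed
  ultimately have "(\<lambda>k. qpoch X2 X2 (2 * k)) \<longlonglongrightarrow> gf (cpairs 3 1) * ?P\<^sup>2"
    by (rule tendsto_fps_X_power_dvd)
  moreover have "(qpoch X2 X2 \<circ> (\<lambda>k. 2 * k)) \<longlonglongrightarrow> qpoch_inf X2 X2"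
    by (rule LIMSEQ_subseq_LIMSEQ[OF qpoch_tendsto_inf]) (simp_all add: strict_mono_def)
  ultimately show ?thesis
    unfolding o_def by (rule LIMSEQ_unique)
qed

lemma qpoch_even_odd: "qpoch (- fps_X) X2 n * qpoch (- X2) X2 n = qpoch (- fps_X) fps_X (2 * n)"
proof (induction n)
  case (Suc n)
  have eqs: "2 * Suc n = Suc (Suc (2 * n))" "X2 ^ n = fps_X ^ (2 * n)"
    by (simp_all only: power_mult) simp
  have "X2 * fps_X ^ (2 * n) = fps_X * fps_X ^ Suc (2 * n)"
    by (simp add: power2_eq_square mult.assoc)
  then show ?case
    unfolding eqs(1) qpoch_Suc Suc.IH [symmetric] eqs(2) mult_minus_left by (simp only: mult_ac)
qed simp

lemma qpoch_plus_minus: "qpoch (- fps_X) fps_X n * qpoch fps_X fps_X n = qpoch X2 X2 n"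
proof (induction n)
  case (Suc n)
  have "1 - X2 * X2 ^ n = (1 - (- fps_X) * fps_X ^ n) * (1 - fps_X * fps_X ^ n)"
    by (simp add: power2_eq_square power_mult_distrib algebra_simps)
  with Suc show ?case
    unfolding qpoch_Suc by (simp only: mult_ac flip: Suc)
qed simp

lemma qpoch_inf_product:
  "qpoch_inf (- fps_X) X2 * qpoch_inf (- X2) X2 * qpoch_inf fps_X fps_X = qpoch_inf X2 X2"
proof -
  have lim: "(\<lambda>k. qpoch a q (2 * k)) \<longlonglongrightarrow> qpoch_inf a q" if "fps_X dvd a" "fps_X dvd q" for a q :: "rat fps"
    using LIMSEQ_subseq_LIMSEQ[OF qpoch_tendsto_inf[OF that], of "\<lambda>k. 2 * k"]
    by (simp add: strict_mono_def o_def)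
  \<comment> \<open>Odd and even factors up to \<open>k\<close> interleave to (-q;q)_(2k), so the
    third product must run to \<open>2 * k\<close> to pair with it.\<close>
  have "(\<lambda>k. qpoch (- fps_X) X2 k * qpoch (- X2) X2 k * qpoch fps_X fps_X (2 * k))
      \<longlonglongrightarrow> qpoch_inf (- fps_X) X2 * qpoch_inf (- X2) X2 * qpoch_inf fps_X fps_X"
    by (intro tendsto_mult_fps qpoch_tendsto_inf lim) auto
  moreover have "(\<lambda>k. qpoch X2 X2 (2 * k)) \<longlonglongrightarrow> qpoch_inf X2 X2"
    by (rule lim) auto
  ultimately show ?thesis
    unfolding qpoch_even_odd qpoch_plus_minus by (rule LIMSEQ_unique)
qed

theorem theorem5p3:
  shows "((\<lambda>\<Lambda>. (fps_X :: rat fps) ^ cylindric_size \<Lambda>) has_sum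
           ((\<Sum>n. fps_X ^ (n\<^sup>2) / qpoch (fps_X\<^sup>2) (fps_X\<^sup>2) n) *
            (qpoch_inf (- (fps_X\<^sup>2)) (fps_X\<^sup>2) / qpoch_inf fps_X fps_X)))
         (cylindric_partitions [3, 1])"
proof -
  let ?A = "qpoch_inf (- fps_X) X2" and ?B = "qpoch_inf (- X2) X2" and ?P = "qpoch_inf fps_X fps_X :: rat fps"
  have P0: "fps_nth ?P 0 = 1"
    by (rule fps_nth_0_qpoch_inf) auto
  then have "?P \<noteq> 0" by auto
  \<comment> \<open>Both sides equal (q^2;q^2)_inf. One factor \<open>?P\<close> then cancels, as
    power series over a field form an integral domain.\<close>
  have "gf (cpairs 3 1) * ?P * ?P = ?A * ?B * ?P"
    using gf_cpairs_eq qpoch_inf_product by (simp add: power2_eq_square mult.assoc)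
  with \<open>?P \<noteq> 0\<close> have AB: "gf (cpairs 3 1) * ?P = ?A * ?B"
    by simp
  have "inverse ?P * ?P = 1"
    by (rule inverse_mult_eq_1) (simp add: P0)
  have "?A * (?B / ?P) = ?A * ?B * inverse ?P"
    by (simp add: fps_divide_unit P0 mult.assoc)
  also have "\<dots> = gf (cpairs 3 1) * (inverse ?P * ?P)"
    unfolding AB [symmetric] by (simp only: mult_ac)
  finally have "?A * (?B / ?P) = gf (cpairs 3 1)"
    unfolding \<open>inverse ?P * ?P = 1\<close> by simp
  then show ?thesis
    using cylindric_partitions_has_sum_gf[of 3 1] sums_unique[OF euler_sum] by simp
qed

end
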